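(* Let $p\in\mathbb{R}[x_1,x_2]$ be a polynomial of degree $4$, let $\mathcal{C}=\{x\in\mathbb{R}^2 : p(x)=0\}$ and $\mathcal{P}=\mathrm{conv}\,\mathcal{C}$. Assume that $\mathcal{P}$ has non-empty interior and that $\{x\in\mathbb{R}^2 : p(x)\ge 0\}\subset\mathcal{P}$. If $p$ is concave on $\mathbb{R}^2$, then $\mathcal{P}=\mathcal{P}_2$.
   Context: First moment relaxation. Consider real vectors $y=(y_\alpha)$ indexed by $\alpha=(\alpha_1,\alpha_2)\in\mathbb{N}^2$ with $|\alpha|=\alpha_1+\alpha_2\le 4$. $M_2(y)$ is the $6\times 6$ symmetric matrix with rows and columns indexed by $\alpha,\beta\in\mathbb{N}^2$, $|\alpha|,|\beta|\le 2$, and entries $y_{\alpha+\beta}$. Writing $p(x)=\sum_\gamma p_\gamma x^\gamma$, put $M_0(py)=\sum_\gamma p_\gamma y_\gamma$. Then $$\mathcal{P}_2=\{x\in\mathbb{R}^2 : \exists\, y \text{ with } y_{00}=1,\ y_{10}=x_1,\ y_{01}=x_2,\ M_2(y)\succeq 0,\ M_0(py)=0\},$$ where $\succeq 0$ means positive semidefinite. *)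

theory Defs
  imports "HOL-Analysis.Analysis" "HOL-Library.Poly_Mapping"
begin

(* The monomial x1^i * x2^j is represented by its exponent (i, j). With componentwise addition of
   exponents, the finitely supported maps below form the ring R[x1, x2] (convolution product). *)
type_synonym bipoly = "(nat \<times> nat) \<Rightarrow>\<^sub>0 real"

definition weight :: "nat \<times> nat \<Rightarrow> nat" where
  "weight \<alpha> = fst \<alpha> + snd \<alpha>"

(* Total degree; by convention 0 for the zero polynomial. *)
definition total_degree :: "bipoly \<Rightarrow> nat" where
  "total_degree p = Max (insert 0 (weight ` Poly_Mapping.keys p))"

definition peval :: "bipoly \<Rightarrow> real^2 \<Rightarrow> real" where
  "peval p x = (\<Sum>\<gamma>\<in>Poly_Mapping.keys p.
     Poly_Mapping.lookup p \<gamma> * ((x $ 1) ^ fst \<gamma> * (x $ 2) ^ snd \<gamma>))"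

definition real_curve :: "bipoly \<Rightarrow> (real^2) set" where
  "real_curve p = {x. peval p x = 0}"

definition multi_indices :: "nat \<Rightarrow> (nat \<times> nat) set" where
  "multi_indices d = {\<alpha>. weight \<alpha> \<le> d}"

(* Positive semidefiniteness of the symmetric matrix (A i j) with rows and columns indexed by I. *)
definition psd_on :: "'i set \<Rightarrow> ('i \<Rightarrow> 'i \<Rightarrow> real) \<Rightarrow> bool" where
  "psd_on I A \<longleftrightarrow> (\<forall>i\<in>I. \<forall>j\<in>I. A i j = A j i) \<and>
     (\<forall>v. 0 \<le> (\<Sum>i\<in>I. \<Sum>j\<in>I. v i * A i j * v j))"

definition moment_matrix :: "(nat \<times> nat \<Rightarrow> real) \<Rightarrow> nat \<times> nat \<Rightarrow> nat \<times> nat \<Rightarrow> real" where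
  "moment_matrix y \<alpha> \<beta> = y (\<alpha> + \<beta>)"

(* The 1 x 1 localizing matrix M_0(p y), identified with its single entry. *)
definition localizing_0 :: "bipoly \<Rightarrow> (nat \<times> nat \<Rightarrow> real) \<Rightarrow> real" where
  "localizing_0 p y = (\<Sum>\<gamma>\<in>Poly_Mapping.keys p. Poly_Mapping.lookup p \<gamma> * y \<gamma>)"

(* The first moment relaxation P_2 for a polynomial p of degree at most 4. The moment vector y is a
   function on all exponents, but only its values at exponents of weight at most 4 are used: the
   moment matrix is restricted to rows and columns of weight at most 2, and p has no monomial of
   weight above 4. *)
definition moment_relaxation_2 :: "bipoly \<Rightarrow> (real^2) set" where
  "moment_relaxation_2 p = {x. \<exists>y. y (0, 0) = 1 \<and> y (1, 0) = x $ 1 \<and> y (0, 1) = x $ 2 \<and>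
     psd_on (multi_indices 2) (moment_matrix y) \<and> localizing_0 p y = 0}"

end

theory Submission
  imports Defs
begin

text \<open>
  Writing L for the functional that a moment vector defines on polynomials of degree at most 4 and
  x for its mean, the point is the Jensen inequality L(p) <= p(x): then L(p) = 0 gives p(x) >= 0,
  so x lies in the convex hull of the curve. For a quartic p the integral remainder in Taylor's
  formula is computed exactly by a two-point quadrature with positive weights, at x and at the
  midpoint of x and z:
    p(z) = p(x) + Dp(x)(z - x) + h(x, z - x) / 6 + h((x + z) / 2, z - x) / 3,
  where h(u, w) is the Hessian form of p at u evaluated at w. Since L(z - x) = 0, it suffices that L is
  nonpositive on h(u, z - x) for u affine in z. Homogenised in u, h is a biquadratic form in
  3 + 2 variables, nonpositive by concavity. L induces a positive semidefinite block matrix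
  ((A, B), (B, D)) with symmetric blocks, and every such matrix is separable: when A is definite, diagonalise A and B
  simultaneously and use the Schur complement D - B A^(-1) B. So L(h) is a sum of (limits of) values of h.
\<close>

subsection \<open>Positive block forms\<close>

text \<open>An isotropic vector of a positive semidefinite form lies in its radical: if
  \<open>g w x\<close> were nonzero, a small step from \<open>w\<close> along a multiple of
  \<open>x\<close> would make the form negative.\<close>

lemma psd_form_kernel:
  fixes g :: "'a::real_vector \<Rightarrow> 'a \<Rightarrow> real"
  assumes g: "bilinear g" and sym: "\<And>x y. g x y = g y x" and S: "subspace S"
    and psd: "\<And>x. x \<in> S \<Longrightarrow> 0 \<le> g x x"
    and w: "w \<in> S" "g w w = 0" and x: "x \<in> S"
  shows "g w x = 0"
proof -
  define c where "c = g w x"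
  \<comment> \<open>The summand 1 keeps the step length \<open>- c / m\<close> defined when
    \<open>g x x = 0\<close>; the form at that step is then a negative multiple of
    \<open>c\<^sup>2\<close>.\<close>
  define m where "m = g x x + 1"
  have m: "m \<ge> 1" using psd[OF x] by (simp add: m_def)
  have "g (w + r *\<^sub>R x) (w + r *\<^sub>R x) = 2 * r * c + r\<^sup>2 * (m - 1)" for r
    using w sym[of x w]
    by (simp add: bilinear_ladd[OF g] bilinear_radd[OF g] bilinear_lmul[OF g] bilinear_rmul[OF g]
        c_def m_def power2_eq_square algebra_simps)
  moreover have "0 \<le> g (w + (- c / m) *\<^sub>R x) (w + (- c / m) *\<^sub>R x)"
    by (intro psd subspace_add subspace_scale S w x)
  ultimately have "0 \<le> 2 * (- c / m) * c + (- c / m)\<^sup>2 * (m - 1)" by (simp only:)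
  also have "\<dots> = - (c\<^sup>2 * (m + 1) / m\<^sup>2)"
    using m by (simp add: field_simps power2_eq_square)
  finally have "c\<^sup>2 * (m + 1) / m\<^sup>2 \<le> 0" by simp
  then have "c\<^sup>2 * (m + 1) \<le> 0" using m by (simp add: divide_le_0_iff)
  then have "c\<^sup>2 \<le> 0" using m by (simp add: mult_le_0_iff)
  then show ?thesis by (simp add: c_def)
qed

text \<open>Induction on the dimension of \<open>S\<close>: a maximiser of the Rayleigh quotient of
  \<open>b\<close> by \<open>a\<close> is an eigenvector of \<open>b\<close> relative to
  \<open>a\<close>, so its \<open>a\<close>-orthogonal complement in \<open>S\<close> is also
  \<open>b\<close>-orthogonal to it, and the induction continues there.\<close>

lemma simultaneous_diagonalisation:
  fixes a b :: "'a::euclidean_space \<Rightarrow> 'a \<Rightarrow> real"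
  assumes a: "bilinear a" and a_sym: "\<And>x y. a x y = a y x" and a_pos: "\<And>x. x \<noteq> 0 \<Longrightarrow> 0 < a x x"
    and b: "bilinear b" and b_sym: "\<And>x y. b x y = b y x"
    and "subspace S"
  shows "\<exists>W. finite W \<and> W \<subseteq> S \<and> span W = S \<and> (\<forall>w\<in>W. a w w = 1) \<and>
    (\<forall>w\<in>W. \<forall>w'\<in>W. w \<noteq> w' \<longrightarrow> a w w' = 0 \<and> b w w' = 0)"
  using \<open>subspace S\<close>
proof (induction "dim S" arbitrary: S rule: less_induct)
  case less
  note S = \<open>subspace S\<close>
  show ?case
  proof (cases "S = {0}")
    case True
    then show ?thesis by (intro exI[of _ "{}"]) auto
  next
    case False
    then obtain z where z: "z \<in> S" "z \<noteq> 0" using subspace_0[OF S] by blast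
    \<comment> \<open>The quotient is invariant under scaling, so its maximum over the compact unit
      sphere of \<open>S\<close> is its maximum over all nonzero vectors of
      \<open>S\<close>.\<close>
    define K where "K = S \<inter> sphere 0 1"
    have "compact K" unfolding K_def
      by (simp add: S closed_Int_compact closed_subspace)
    moreover have "(1 / norm z) *\<^sub>R z \<in> K"
      using z by (simp add: K_def subspace_scale[OF S])
    then have "K \<noteq> {}" by blast
    moreover have "continuous_on K (\<lambda>x. b x x / a x x)"
    proof -
      have "a x x \<noteq> 0" if "x \<in> K" for x
        using that a_pos[of x] by (cases "x = 0") (auto simp: K_def)
      then show ?thesis
        by (intro continuous_on_divide bilinear_continuous_on_compose[OF _ _ a]
          bilinear_continuous_on_compose[OF _ _ b] continuous_on_id) auto
    qed
    ultimately obtain v where v: "v \<in> K" and vmax: "\<And>x. x \<in> K \<Longrightarrow> b x x / a x x \<le> b v v / a v v"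
      using continuous_attains_sup[of K "\<lambda>x. b x x / a x x"] by blast
    define \<mu> where "\<mu> = b v v / a v v"
    have vS: "v \<in> S" and v0: "v \<noteq> 0" using v by (auto simp: K_def)
    \<comment> \<open>By maximality \<open>g\<close> is positive semidefinite on \<open>S\<close>
      and vanishes at \<open>v\<close>. Hence \<open>v\<close> is in its radical, which is the
      eigenvector equation \<open>b v x = \<mu> * a v x\<close> on \<open>S\<close>.\<close>
    define g where "g x y = \<mu> * a x y - b x y" for x y
    have bil_g: "bilinear g"
      unfolding bilinear_def linear_iff g_def
      by (simp add: bilinear_ladd[OF a] bilinear_radd[OF a] bilinear_lmul[OF a] bilinear_rmul[OF a]
        bilinear_ladd[OF b] bilinear_radd[OF b] bilinear_lmul[OF b] bilinear_rmul[OF b] algebra_simps)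
    have g_psd: "0 \<le> g x x" if "x \<in> S" for x
    proof (cases "x = 0")
      case True
      then show ?thesis by (simp add: bilinear_lzero[OF bil_g])
    next
      case False
      let ?u = "(1 / norm x) *\<^sub>R x"
      have "?u \<in> K" using that False by (simp add: K_def subspace_scale[OF S])
      then have "b ?u ?u / a ?u ?u \<le> \<mu>" using vmax \<mu>_def by blast
      moreover have "b ?u ?u / a ?u ?u = b x x / a x x"
        using False by (simp add: bilinear_lmul[OF a] bilinear_rmul[OF a]
            bilinear_lmul[OF b] bilinear_rmul[OF b])
      ultimately have "b x x / a x x \<le> \<mu>" by simp
      then show ?thesis using a_pos[OF False] by (simp add: g_def field_simps)
    qed
    define w where "w = (1 / sqrt (a v v)) *\<^sub>R v"
    have wS: "w \<in> S" using vS by (simp add: w_def subspace_scale[OF S])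
    have aw: "a w w = 1" using a_pos[OF v0]
      by (simp add: w_def bilinear_lmul[OF a] bilinear_rmul[OF a] real_sqrt_mult_self
          flip: power2_eq_square)
    have "g v v = 0" using a_pos[OF v0] by (simp add: g_def \<mu>_def)
    then have gw: "g w w = 0"
      by (simp add: w_def bilinear_lmul[OF bil_g] bilinear_rmul[OF bil_g])
    have g_sym: "g x y = g y x" for x y by (simp add: g_def a_sym[of x] b_sym[of x])
    have bw: "b w x = \<mu> * a w x" if "x \<in> S" for x
      using psd_form_kernel[OF bil_g g_sym S g_psd wS gw that] by (simp add: g_def)
    define S' where "S' = {x \<in> S. a w x = 0}"
    have S': "subspace S'"
      unfolding S'_def subspace_def
      by (auto simp: bilinear_rzero[OF a] bilinear_radd[OF a] bilinear_rmul[OF a]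
          subspace_0[OF S] subspace_add[OF S] subspace_scale[OF S])
    have "w \<notin> S'" using aw by (simp add: S'_def)
    then have "S' \<subset> S" using wS by (auto simp: S'_def)
    then have "dim S' < dim S"
      by (metis S S' dim_subset order_le_less psubsetE subspace_dim_equal)
    then obtain W where W: "finite W" "W \<subseteq> S'" "span W = S'" "\<forall>w\<in>W. a w w = 1"
      "\<forall>w\<in>W. \<forall>w'\<in>W. w \<noteq> w' \<longrightarrow> a w w' = 0 \<and> b w w' = 0"
      using less.hyps[OF _ S'] by blast
    have WS: "insert w W \<subseteq> S" using W wS by (auto simp: S'_def)
    have "x \<in> span (insert w W)" if "x \<in> S" for x
    proof -
      have "x - a w x *\<^sub>R w \<in> S'"
        using that wS aw by (simp add: S'_def bilinear_rsub[OF a] bilinear_rmul[OF a]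
            subspace_diff[OF S] subspace_scale[OF S])
      then show ?thesis unfolding span_insert W(3)[symmetric] by blast
    qed
    then have "span (insert w W) = S"
      using WS S by (meson span_minimal subsetI subset_antisym)
    moreover have "a w x = 0 \<and> b w x = 0 \<and> a x w = 0 \<and> b x w = 0" if "x \<in> W" for x
      using that W(2) bw[of x] a_sym[of x w] b_sym[of x w] by (auto simp: S'_def)
    ultimately show ?thesis
      using W WS aw by (intro exI[of _ "insert w W"]) auto
  qed
qed

lemma orthonormal_expansion:
  fixes a :: "'a::real_vector \<Rightarrow> 'a \<Rightarrow> real"
  assumes a: "bilinear a" and W: "finite W" "span W = UNIV" "\<forall>w\<in>W. a w w = 1"
    "\<forall>w\<in>W. \<forall>w'\<in>W. w \<noteq> w' \<longrightarrow> a w w' = 0"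
  shows "x = (\<Sum>w\<in>W. a x w *\<^sub>R w)"
proof -
  obtain c where c: "x = (\<Sum>w\<in>W. c w *\<^sub>R w)"
    using W span_finite[OF W(1)] by (metis (mono_tags, lifting) UNIV_I imageE)
  have "a x w = c w" if "w \<in> W" for w
  proof -
    have "a x w = (\<Sum>u\<in>W. c u * a u w)"
    proof -
      have "linear (\<lambda>y. a y w)" using a by (simp add: bilinear_def)
      then show ?thesis unfolding c by (simp add: linear_sum[of "\<lambda>y. a y w"] linear_scale[of "\<lambda>y. a y w"])
    qed
    also have "\<dots> = (\<Sum>u\<in>W. if u = w then c u else 0)"
      using W that by (intro sum.cong) auto
    finally show ?thesis using W(1) that by simp
  qed
  then have "(\<Sum>w\<in>W. a x w *\<^sub>R w) = (\<Sum>w\<in>W. c w *\<^sub>R w)" by (intro sum.cong) simp_all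
  with c show ?thesis by (rule trans[OF _ sym])
qed

text \<open>The numbers \<open>a x w\<close> are the coordinates of \<open>x\<close> in the basis
  \<open>W\<close>, so \<open>b\<close> becomes a combination of rank-one forms, as
  \<open>pairing_rank_ones\<close> expects.\<close>

lemma bilinear_diagonal:
  fixes a b :: "'a::real_vector \<Rightarrow> 'a \<Rightarrow> real"
  assumes a: "bilinear a" and b: "bilinear b"
    and W: "finite W" "span W = UNIV" "\<forall>w\<in>W. a w w = 1"
    "\<forall>w\<in>W. \<forall>w'\<in>W. w \<noteq> w' \<longrightarrow> a w w' = 0 \<and> b w w' = 0"
  shows "b x y = (\<Sum>w\<in>W. b w w * a x w * a y w)"
proof -
  have W0: "\<forall>w\<in>W. \<forall>w'\<in>W. w \<noteq> w' \<longrightarrow> a w w' = 0" using W(4) by blast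
  note ex = orthonormal_expansion[OF a W(1-3) W0]
  have "b x y = b (\<Sum>w\<in>W. a x w *\<^sub>R w) (\<Sum>w\<in>W. a y w *\<^sub>R w)"
    by (rule arg_cong2[of _ _ _ _ b, OF ex ex])
  also have "\<dots> = (\<Sum>w\<in>W. \<Sum>u\<in>W. a x w * a y u * b w u)"
    by (simp add: bilinear_sum[OF b] sum.cartesian_product bilinear_lmul[OF b] bilinear_rmul[OF b] mult_ac)
  also have "\<dots> = (\<Sum>w\<in>W. \<Sum>u\<in>W. if u = w then b w w * a x w * a y w else 0)"
    using W(4) by (intro sum.cong) auto
  finally show ?thesis using W(1) by simp
qed

section \<open>Trace pairing of forms and separability of block forms\<close>

text \<open>The trace inner product of the two Gram matrices in the standard basis. With moments in
  \<open>a\<close> and coefficients in \<open>P\<close> it is the value of a functional on a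
  quadratic form.\<close>

definition pairing :: "('a::euclidean_space \<Rightarrow> 'a \<Rightarrow> real) \<Rightarrow> ('a \<Rightarrow> 'a \<Rightarrow> real) \<Rightarrow> real" where
  "pairing a P = (\<Sum>i\<in>Basis. \<Sum>j\<in>Basis. a i j * P i j)"

text \<open>The sum over \<open>Basis\<close> is the vector that represents the linear functional
  \<open>c w\<close> through the inner product; pairing with a rank-one form evaluates
  \<open>P\<close> there.\<close>

lemma pairing_rank_ones:
  assumes P: "bilinear P" and lin: "\<And>w. w \<in> W \<Longrightarrow> linear (c w)"
    and a: "\<And>x y. a x y = (\<Sum>w\<in>W. \<beta> w * c w x * c w y)"
  shows "pairing a P = (\<Sum>w\<in>W. \<beta> w * P (\<Sum>i\<in>Basis. c w i *\<^sub>R i) (\<Sum>i\<in>Basis. c w i *\<^sub>R i))"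
proof -
  have "pairing a P = (\<Sum>i\<in>Basis. \<Sum>w\<in>W. \<Sum>j\<in>Basis. \<beta> w * c w i * c w j * P i j)"
    unfolding pairing_def a sum_distrib_right by (intro sum.cong refl sum.swap)
  also have "\<dots> = (\<Sum>w\<in>W. \<Sum>i\<in>Basis. \<Sum>j\<in>Basis. \<beta> w * c w i * c w j * P i j)"
    by (rule sum.swap)
  also have "\<dots> = (\<Sum>w\<in>W. \<beta> w * P (\<Sum>i\<in>Basis. c w i *\<^sub>R i) (\<Sum>i\<in>Basis. c w i *\<^sub>R i))"
    by (simp add: bilinear_sum[OF P] sum.cartesian_product[symmetric] bilinear_lmul[OF P] bilinear_rmul[OF P]
        sum_distrib_left mult_ac)
  finally show ?thesis .
qed

lemma pairing_add_left: "pairing (\<lambda>x y. a x y + b x y) P = pairing a P + pairing b P"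
  by (simp add: pairing_def distrib_right sum.distrib)

lemma pairing_scale_left: "pairing (\<lambda>x y. c * a x y) P = c * pairing a P"
  by (simp add: pairing_def sum_distrib_left mult.assoc)

lemma bilinear_inner_real: "bilinear (inner :: 'a::euclidean_space \<Rightarrow> 'a \<Rightarrow> real)"
  by (simp add: bilinear_def linear_iff inner_add_left inner_add_right)

text \<open>Diagonalising \<open>d\<close> in an orthonormal basis turns the pairing into a sum of
  products of a nonnegative eigenvalue with a value of \<open>R\<close>.\<close>

lemma pairing_psd_nonneg:
  fixes d R :: "'a::euclidean_space \<Rightarrow> 'a \<Rightarrow> real"
  assumes d: "bilinear d" "\<And>x y. d x y = d y x" "\<And>x. 0 \<le> d x x"
    and R: "bilinear R" "\<And>x. 0 \<le> R x x"
  shows "0 \<le> pairing d R"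
proof -
  obtain W :: "'a set" where W: "finite W" "span W = UNIV" "\<forall>w\<in>W. w \<bullet> w = 1"
    "\<forall>w\<in>W. \<forall>w'\<in>W. w \<noteq> w' \<longrightarrow> w \<bullet> w' = 0 \<and> d w w' = 0"
    using simultaneous_diagonalisation[OF bilinear_inner_real inner_commute _ d(1,2) subspace_UNIV]
    by auto
  have "pairing d R = (\<Sum>w\<in>W. d w w * R (\<Sum>i\<in>Basis. (i \<bullet> w) *\<^sub>R i) (\<Sum>i\<in>Basis. (i \<bullet> w) *\<^sub>R i))"
    by (rule pairing_rank_ones[OF R(1), of W "\<lambda>w x. x \<bullet> w"])
      (simp add: linear_iff inner_add_left, rule bilinear_diagonal[OF bilinear_inner_real d(1) W])
  also have "\<dots> \<ge> 0" by (intro sum_nonneg mult_nonneg_nonneg d R)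
  finally show ?thesis .
qed

text \<open>The block form splits as the sum over \<open>w\<close> of the rank-one form of
  \<open>c w\<close> tensored with the 2 x 2 matrix ((1, \<beta>), (\<beta>, \<beta>^2)), plus the
  Schur complement \<open>f\<close> in the lower corner. The summands pair to values of the given
  form, and the rest is a pairing of two semidefinite forms.\<close>

lemma pairing_block_nonneg_definite:
  fixes a b d P Q R :: "'a::euclidean_space \<Rightarrow> 'a \<Rightarrow> real"
  assumes a: "bilinear a" "\<And>x y. a x y = a y x" "\<And>x. x \<noteq> 0 \<Longrightarrow> 0 < a x x"
    and b: "bilinear b" "\<And>x y. b x y = b y x"
    and d: "bilinear d" "\<And>x y. d x y = d y x"
    and block: "\<And>x y. 0 \<le> a x x + 2 * b x y + d y y"
    and P: "bilinear P" and Q: "bilinear Q" and R: "bilinear R"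
    and form: "\<And>x s t. 0 \<le> s\<^sup>2 * P x x + 2 * s * t * Q x x + t\<^sup>2 * R x x"
  shows "0 \<le> pairing a P + 2 * pairing b Q + pairing d R"
proof -
  obtain W :: "'a set" where W: "finite W" "span W = UNIV" "\<forall>w\<in>W. a w w = 1"
    "\<forall>w\<in>W. \<forall>w'\<in>W. w \<noteq> w' \<longrightarrow> a w w' = 0 \<and> b w w' = 0"
    using simultaneous_diagonalisation[OF a b subspace_UNIV] by auto
  define \<beta> where "\<beta> w = b w w" for w
  define c where "c w x = a x w" for w x
  define v where "v w = (\<Sum>i\<in>Basis. c w i *\<^sub>R i)" for w
  have lin: "linear (c w)" for w using a(1) unfolding c_def[abs_def] bilinear_def by blast
  have a_eq: "a x y = (\<Sum>w\<in>W. 1 * c w x * c w y)" for x y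
  proof -
    have "a x y = (\<Sum>w\<in>W. a w w * a x w * a y w)"
      by (rule bilinear_diagonal[OF a(1) a(1) W(1-3)]) (use W(4) in blast)
    also have "\<dots> = (\<Sum>w\<in>W. 1 * c w x * c w y)"
      using W(3) by (intro sum.cong) (simp_all add: c_def)
    finally show ?thesis .
  qed
  have b_eq: "b x y = (\<Sum>w\<in>W. \<beta> w * c w x * c w y)" for x y
    unfolding c_def \<beta>_def by (rule bilinear_diagonal[OF a(1) b(1) W])
  \<comment> \<open>In the coordinates of \<open>W\<close>, \<open>a\<close> is the identity and
    \<open>b\<close> is diagonal, so this is B A^(-1) B and \<open>f\<close> is the Schur
    complement.\<close>
  define e where "e x y = (\<Sum>w\<in>W. (\<beta> w)\<^sup>2 * c w x * c w y)" for x y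
  define f where "f x y = d x y - e x y" for x y
  have e_bil: "bilinear e"
    unfolding bilinear_def e_def linear_iff
    by (simp add: linear_add[OF lin] linear_scale[OF lin] sum.distrib sum_distrib_left algebra_simps)
  have f_bil: "bilinear f"
    using d(1) e_bil unfolding f_def bilinear_def linear_iff by (simp add: algebra_simps)
  have f_sym: "f x y = f y x" for x y
    by (simp add: f_def d(2)[of x] e_def mult_ac)
  txt \<open>Evaluate the block form at (u, y) where u minimises it, i.e. u is the vector - A^(-1) B y.\<close>
  have f_psd: "0 \<le> f y y" for y
  proof -
    define u where "u = (\<Sum>w\<in>W. (- \<beta> w * c w y) *\<^sub>R w)"
    have cu: "c w u = - \<beta> w * c w y" if "w \<in> W" for w
    proof -
      have "c w u = (\<Sum>w'\<in>W. - \<beta> w' * c w' y * c w w')"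
        by (simp add: u_def linear_sum[OF lin] linear_scale[OF lin] linear_neg[OF lin])
      also have "\<dots> = (\<Sum>w'\<in>W. if w' = w then - \<beta> w' * c w' y else 0)"
        using W that by (intro sum.cong) (auto simp: c_def)
      finally show ?thesis using W(1) that by simp
    qed
    have "a u u = e y y" unfolding a_eq e_def
      by (intro sum.cong) (simp_all add: cu power2_eq_square)
    moreover have "b u y = - e y y" unfolding b_eq e_def sum_negf[symmetric]
      by (intro sum.cong) (simp_all add: cu power2_eq_square)
    ultimately show ?thesis using block[of u y] by (simp add: f_def)
  qed
  have "0 \<le> R x x" for x using form[of 0 x 1] by simp
  then have "0 \<le> pairing f R" by (intro pairing_psd_nonneg f_bil f_sym f_psd R)
  moreover have "pairing d R = pairing e R + pairing f R"
    using pairing_add_left[of e f R] by (simp add: f_def)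
  \<comment> \<open>Each summand is the hypothesis \<open>form\<close> at \<open>s = 1\<close>,
    \<open>t = \<beta> w\<close> and the vector \<open>v w\<close>.\<close>
  moreover have "pairing a P + 2 * pairing b Q + pairing e R =
      (\<Sum>w\<in>W. 1\<^sup>2 * P (v w) (v w) + 2 * 1 * \<beta> w * Q (v w) (v w) + (\<beta> w)\<^sup>2 * R (v w) (v w))"
    unfolding pairing_rank_ones[OF P lin a_eq] pairing_rank_ones[OF Q lin b_eq]
      pairing_rank_ones[OF R lin e_def] v_def[symmetric]
    by (simp add: sum.distrib sum_distrib_left mult.assoc)
  moreover have "\<dots> \<ge> 0" by (intro sum_nonneg form)
  ultimately show ?thesis by simp
qed

text \<open>Let \<open>t\<close> tend to 0 from above. This serves three limits: from definite to
  semidefinite blocks, from second differences to the Hessian, and from finite points to points at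
  infinity.\<close>

lemma nonneg_if_nonneg_perturbed:
  fixes A B C :: real
  assumes "\<And>t. 0 < t \<Longrightarrow> 0 \<le> A + t * B + t\<^sup>2 * C"
  shows "0 \<le> A"
proof (rule tendsto_lowerbound[of _ _ "at_right 0"])
  show "((\<lambda>t. A + t * B + t\<^sup>2 * C) \<longlongrightarrow> A) (at_right 0)"
    by (auto intro!: tendsto_eq_intros)
  show "\<forall>\<^sub>F t in at_right 0. 0 \<le> A + t * B + t\<^sup>2 * C"
    using assms by (intro eventually_at_rightI[of 0 1]) auto
qed simp

text \<open>Adding \<open>t\<close> times the inner product makes the first block definite and
  preserves the block inequality; the resulting bound is affine in \<open>t\<close>.\<close>

lemma pairing_block_nonneg:
  fixes a b d P Q R :: "'a::euclidean_space \<Rightarrow> 'a \<Rightarrow> real"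
  assumes a: "bilinear a" "\<And>x y. a x y = a y x"
    and b: "bilinear b" "\<And>x y. b x y = b y x"
    and d: "bilinear d" "\<And>x y. d x y = d y x"
    and block: "\<And>x y. 0 \<le> a x x + 2 * b x y + d y y"
    and P: "bilinear P" and Q: "bilinear Q" and R: "bilinear R"
    and form: "\<And>x s t. 0 \<le> s\<^sup>2 * P x x + 2 * s * t * Q x x + t\<^sup>2 * R x x"
  shows "0 \<le> pairing a P + 2 * pairing b Q + pairing d R"
proof (rule nonneg_if_nonneg_perturbed[of _ "pairing inner P" 0])
  fix t :: real assume t: "0 < t"
  define a' where "a' x y = a x y + t * (x \<bullet> y)" for x y
  have a_psd: "0 \<le> a x x" for x
    using block[of x 0] by (simp add: bilinear_rzero[OF b(1)] bilinear_rzero[OF d(1)])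
  have a': "bilinear a'"
    using a(1) unfolding a'_def bilinear_def linear_iff
    by (simp add: algebra_simps inner_add_left inner_add_right)
  have "0 \<le> pairing a' P + 2 * pairing b Q + pairing d R"
  proof (rule pairing_block_nonneg_definite[OF a' _ _ b d _ P Q R form])
    show "a' x y = a' y x" for x y by (simp add: a'_def a(2)[of x] inner_commute)
    show "0 < a' x x" if "x \<noteq> 0" for x
      using that t a_psd[of x] by (simp add: a'_def add_nonneg_pos)
    show "0 \<le> a' x x + 2 * b x y + d y y" for x y
      using add_mono[OF block[of x y] mult_nonneg_nonneg[of t "x \<bullet> x"]] t by (simp add: a'_def)
  qed
  then show "0 \<le> pairing a P + 2 * pairing b Q + pairing d R + t * pairing inner P + t\<^sup>2 * 0"
    by (simp add: a'_def[abs_def] pairing_add_left pairing_scale_left)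
qed

subsection \<open>Bivariate quartics\<close>

text \<open>The ring is arbitrary because the same formula is used over the reals, to evaluate
  \<open>p\<close>, and over the polynomials themselves, with polynomials as arguments.\<close>

definition quartic :: "(nat \<Rightarrow> nat \<Rightarrow> 'a::comm_ring_1) \<Rightarrow> 'a \<Rightarrow> 'a \<Rightarrow> 'a" where
  "quartic c x y = (\<Sum>i\<le>4. \<Sum>j\<le>4 - i. c i j * (x ^ i * y ^ j))"

text \<open>
  The entries of the Hessian of the quartic at the point (x0 : x1 : x2), homogenised by x0. They are
  polarised to bilinear forms in x and y (not symmetric ones: the mixed terms are put on one side).
\<close>

definition hess_xx :: "(nat \<Rightarrow> nat \<Rightarrow> 'a::comm_ring_1) \<Rightarrow> 'a \<Rightarrow> 'a \<Rightarrow> 'a \<Rightarrow> 'a \<Rightarrow> 'a \<Rightarrow> 'a \<Rightarrow> 'a" where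
  "hess_xx c x0 x1 x2 y0 y1 y2 = 2 * c 2 0 * (x0 * y0) + 6 * c 3 0 * (x0 * y1) + 2 * c 2 1 * (x0 * y2)
     + 12 * c 4 0 * (x1 * y1) + 6 * c 3 1 * (x1 * y2) + 2 * c 2 2 * (x2 * y2)"

definition hess_xy :: "(nat \<Rightarrow> nat \<Rightarrow> 'a::comm_ring_1) \<Rightarrow> 'a \<Rightarrow> 'a \<Rightarrow> 'a \<Rightarrow> 'a \<Rightarrow> 'a \<Rightarrow> 'a \<Rightarrow> 'a" where
  "hess_xy c x0 x1 x2 y0 y1 y2 = c 1 1 * (x0 * y0) + 2 * c 2 1 * (x0 * y1) + 2 * c 1 2 * (x0 * y2)
     + 3 * c 3 1 * (x1 * y1) + 4 * c 2 2 * (x1 * y2) + 3 * c 1 3 * (x2 * y2)"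

definition hess_yy :: "(nat \<Rightarrow> nat \<Rightarrow> 'a::comm_ring_1) \<Rightarrow> 'a \<Rightarrow> 'a \<Rightarrow> 'a \<Rightarrow> 'a \<Rightarrow> 'a \<Rightarrow> 'a \<Rightarrow> 'a" where
  "hess_yy c x0 x1 x2 y0 y1 y2 = 2 * c 0 2 * (x0 * y0) + 2 * c 1 2 * (x0 * y1) + 6 * c 0 3 * (x0 * y2)
     + 2 * c 2 2 * (x1 * y1) + 6 * c 1 3 * (x1 * y2) + 12 * c 0 4 * (x2 * y2)"

definition hess :: "(nat \<Rightarrow> nat \<Rightarrow> 'a::comm_ring_1) \<Rightarrow> 'a \<Rightarrow> 'a \<Rightarrow> 'a \<Rightarrow> 'a \<Rightarrow> 'a \<Rightarrow> 'a" where
  "hess c x0 x1 x2 v w = hess_xx c x0 x1 x2 x0 x1 x2 * v\<^sup>2 + 2 * hess_xy c x0 x1 x2 x0 x1 x2 * (v * w)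
     + hess_yy c x0 x1 x2 x0 x1 x2 * w\<^sup>2"

definition quartic_x :: "(nat \<Rightarrow> nat \<Rightarrow> 'a::comm_ring_1) \<Rightarrow> 'a \<Rightarrow> 'a \<Rightarrow> 'a" where
  "quartic_x c x y = c 1 0 + 2 * c 2 0 * x + c 1 1 * y + 3 * c 3 0 * x^2 + 2 * c 2 1 * x * y + c 1 2 * y^2
     + 4 * c 4 0 * x^3 + 3 * c 3 1 * x^2 * y + 2 * c 2 2 * x * y^2 + c 1 3 * y^3"

definition quartic_y :: "(nat \<Rightarrow> nat \<Rightarrow> 'a::comm_ring_1) \<Rightarrow> 'a \<Rightarrow> 'a \<Rightarrow> 'a" where
  "quartic_y c x y = c 0 1 + c 1 1 * x + 2 * c 0 2 * y + c 2 1 * x^2 + 2 * c 1 2 * x * y + 3 * c 0 3 * y^2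
     + c 3 1 * x^3 + 2 * c 2 2 * x^2 * y + 3 * c 1 3 * x * y^2 + 4 * c 0 4 * y^3"

lemma quartic_expand:
  "quartic c x y = c 0 0 + c 0 1 * y + c 0 2 * y^2 + c 0 3 * y^3 + c 0 4 * y^4
     + c 1 0 * x + c 1 1 * x * y + c 1 2 * x * y^2 + c 1 3 * x * y^3
     + c 2 0 * x^2 + c 2 1 * x^2 * y + c 2 2 * x^2 * y^2
     + c 3 0 * x^3 + c 3 1 * x^3 * y + c 4 0 * x^4"
proof -
  have "{..4::nat} = {0,1,2,3,4}" "{..3::nat} = {0,1,2,3}" "{..2::nat} = {0,1,2}" by auto
  then show ?thesis
    by (simp add: quartic_def mult.assoc add.assoc)
qed

text \<open>
  The quadrature formula multiplied by 6, for the points (x, y) and (x + 2 v, y + 2 w): this way it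
  is an identity with integer coefficients, valid in every commutative ring.
\<close>

lemma quartic_taylor:
  fixes c :: "nat \<Rightarrow> nat \<Rightarrow> 'a::comm_ring_1"
  shows "6 * quartic c (x + 2 * v) (y + 2 * w) =
    6 * quartic c x y + 12 * (quartic_x c x y * v + quartic_y c x y * w)
    + 4 * hess c 1 x y v w + 8 * hess c 1 (x + v) (y + w) v w"
  unfolding quartic_expand quartic_x_def quartic_y_def hess_def hess_xx_def hess_xy_def hess_yy_def
  by (simp add: algebra_simps power2_eq_square power3_eq_cube power4_eq_xxxx)

text \<open>Odd orders cancel in the symmetric difference, leaving the Hessian form and twice the
  leading quartic form. This links midpoint concavity to the Hessian by algebra, without
  derivatives.\<close>

lemma quartic_second_difference:
  fixes c :: "nat \<Rightarrow> nat \<Rightarrow> 'a::comm_ring_1"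
  shows "quartic c (x + v) (y + w) + quartic c (x - v) (y - w) - 2 * quartic c x y =
    hess c 1 x y v w + 2 * (c 4 0 * v^4 + c 3 1 * v^3 * w + c 2 2 * v^2 * w^2 + c 1 3 * v * w^3 + c 0 4 * w^4)"
  unfolding quartic_expand hess_def hess_xx_def hess_xy_def hess_yy_def
  by (simp add: algebra_simps power2_eq_square power3_eq_cube power4_eq_xxxx)

lemma hess_homogeneous:
  fixes c :: "nat \<Rightarrow> nat \<Rightarrow> 'a::comm_ring_1"
  shows "hess c (t * x0) (t * x1) (t * x2) v w = t\<^sup>2 * hess c x0 x1 x2 v w"
  unfolding hess_def hess_xx_def hess_xy_def hess_yy_def
  by (simp add: algebra_simps power2_eq_square)

text \<open>Shrinking the direction by \<open>t\<close> and dividing by \<open>t\<^sup>2\<close>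
  gives the claim at affine points. Homogeneity extends it to \<open>x0 \<noteq> 0\<close>, and a
  limit to the points at infinity.\<close>

lemma hess_nonpos_of_midpoint_concave:
  fixes c :: "nat \<Rightarrow> nat \<Rightarrow> real"
  assumes mid: "\<And>x y v w. quartic c (x + v) (y + w) + quartic c (x - v) (y - w) \<le> 2 * quartic c x y"
  shows "hess c x0 x1 x2 v w \<le> 0"
proof -
  have affine: "hess c 1 x y v w \<le> 0" for x y
  proof -
    let ?K = "2 * (c 4 0 * v^4 + c 3 1 * v^3 * w + c 2 2 * v^2 * w^2 + c 1 3 * v * w^3 + c 0 4 * w^4)"
    have "0 \<le> - hess c 1 x y v w + t * 0 + t\<^sup>2 * (- ?K)" if "0 < t" for t
    proof -
      have "t\<^sup>2 * (hess c 1 x y v w + t\<^sup>2 * ?K) = hess c 1 x y (t * v) (t * w) +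
        2 * (c 4 0 * (t * v)^4 + c 3 1 * (t * v)^3 * (t * w) + c 2 2 * (t * v)^2 * (t * w)^2
          + c 1 3 * (t * v) * (t * w)^3 + c 0 4 * (t * w)^4)"
        unfolding hess_def by algebra
      also have "\<dots> \<le> 0"
        using mid[of x "t * v" y "t * w"] unfolding quartic_second_difference[symmetric] by simp
      finally have "hess c 1 x y v w + t\<^sup>2 * ?K \<le> 0"
        using that by (simp add: mult_le_0_iff)
      then show ?thesis by (simp only: mult_minus_right mult_zero_right)
    qed
    then have "0 \<le> - hess c 1 x y v w" by (rule nonneg_if_nonneg_perturbed)
    then show ?thesis by simp
  qed
  have finite_point: "hess c t x1 x2 v w \<le> 0" if "t \<noteq> 0" for t
  proof -
    have "hess c t x1 x2 v w = t\<^sup>2 * hess c 1 (x1 / t) (x2 / t) v w"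
      using that hess_homogeneous[of c t 1 "x1 / t" "x2 / t" v w] by simp
    then show ?thesis using affine by (simp add: mult_le_0_iff)
  qed
  show ?thesis
  proof (cases "x0 = 0")
    case True
    \<comment> \<open>The coefficient of \<open>t\<close> in the quadratic polynomial
      \<open>hess c t x1 x2 v w\<close>.\<close>
    define B where "B = v\<^sup>2 * (6 * c 3 0 * x1 + 2 * c 2 1 * x2) + 2 * v * w * (2 * c 2 1 * x1 + 2 * c 1 2 * x2)
      + w\<^sup>2 * (2 * c 1 2 * x1 + 6 * c 0 3 * x2)"
    have "0 \<le> - hess c 0 x1 x2 v w + t * (- B) + t\<^sup>2 * (- hess c 1 0 0 v w)" if "0 < t" for t
    proof -
      have "hess c t x1 x2 v w = hess c 0 x1 x2 v w + t * B + t\<^sup>2 * hess c 1 0 0 v w"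
        unfolding B_def hess_def hess_xx_def hess_xy_def hess_yy_def by algebra
      then show ?thesis using finite_point[of t] that by simp
    qed
    then have "0 \<le> - hess c 0 x1 x2 v w" by (rule nonneg_if_nonneg_perturbed)
    then show ?thesis using True by simp
  qed (rule finite_point)
qed

subsection \<open>Pseudo-moment functionals\<close>

abbreviation bconst :: "real \<Rightarrow> bipoly" where
  "bconst \<equiv> Poly_Mapping.single 0"

abbreviation X1 :: bipoly where
  "X1 \<equiv> Poly_Mapping.single (1, 0) 1"

abbreviation X2 :: bipoly where
  "X2 \<equiv> Poly_Mapping.single (0, 1) 1"

lemma bconst_mult: "bconst (r * s) = bconst r * bconst s"
  by (simp add: mult_single)

lemma bconst_power: "bconst (r ^ n) = bconst r ^ n"
  by (induction n) (simp_all add: bconst_mult)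

lemma bconst_numeral: "bconst (numeral n) = numeral n"
  by simp

lemma single_monomial: "Poly_Mapping.single (i, j) r = bconst r * (X1 ^ i * X2 ^ j)"
proof -
  have "X1 ^ i = Poly_Mapping.single (i, 0) 1"
    by (induction i) (simp_all add: mult_single zero_prod_def[symmetric])
  moreover have "X2 ^ j = Poly_Mapping.single (0, j) 1"
    by (induction j) (simp_all add: mult_single zero_prod_def[symmetric])
  ultimately show ?thesis by (simp add: mult_single)
qed

lemma sum_single_lookup:
  "(\<Sum>\<gamma>\<in>Poly_Mapping.keys p. Poly_Mapping.single \<gamma> (Poly_Mapping.lookup p \<gamma>)) = p"
  by (rule poly_mapping_eqI)
    (auto simp: lookup_sum lookup_single when_def in_keys_iff sum.delta)

lemma multi_indices_eq_Sigma: "multi_indices d = Sigma {..d} (\<lambda>i. {..d - i})"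
  by (auto simp: multi_indices_def weight_def)

lemma sum_multi_indices: "sum f (multi_indices d) = (\<Sum>i\<le>d. \<Sum>j\<le>d - i. f (i, j))"
  unfolding multi_indices_eq_Sigma by (subst sum.Sigma) simp_all

lemma finite_multi_indices: "finite (multi_indices d)"
  by (simp add: multi_indices_eq_Sigma)

lemma keys_subset_multi_indices: "Poly_Mapping.keys p \<subseteq> multi_indices (total_degree p)"
  by (auto simp: multi_indices_def total_degree_def)

text \<open>A polynomial is its own value at the variables, so the ring identity
  \<open>quartic_taylor\<close> applies to \<open>p\<close> itself.\<close>

lemma bipoly_eq_quartic:
  assumes "Poly_Mapping.keys p \<subseteq> multi_indices 4"
  shows "p = quartic (\<lambda>i j. bconst (Poly_Mapping.lookup p (i, j))) X1 X2"
proof -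
  have "p = (\<Sum>\<gamma>\<in>Poly_Mapping.keys p. Poly_Mapping.single \<gamma> (Poly_Mapping.lookup p \<gamma>))"
    by (rule sum_single_lookup[symmetric])
  also have "\<dots> = (\<Sum>\<gamma>\<in>multi_indices 4. Poly_Mapping.single \<gamma> (Poly_Mapping.lookup p \<gamma>))"
    by (rule sum.mono_neutral_left[OF finite_multi_indices assms]) (simp add: in_keys_iff)
  also have "\<dots> = quartic (\<lambda>i j. bconst (Poly_Mapping.lookup p (i, j))) X1 X2"
    unfolding quartic_def sum_multi_indices by (intro sum.cong refl single_monomial)
  finally show ?thesis .
qed

lemma peval_eq_quartic:
  assumes "Poly_Mapping.keys p \<subseteq> multi_indices 4"
  shows "peval p x = quartic (\<lambda>i j. Poly_Mapping.lookup p (i, j)) (x $ 1) (x $ 2)"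
proof -
  have "peval p x = (\<Sum>\<gamma>\<in>multi_indices 4. Poly_Mapping.lookup p \<gamma> * ((x $ 1) ^ fst \<gamma> * (x $ 2) ^ snd \<gamma>))"
    unfolding peval_def
    by (rule sum.mono_neutral_left[OF finite_multi_indices assms]) (simp add: in_keys_iff)
  also have "\<dots> = quartic (\<lambda>i j. Poly_Mapping.lookup p (i, j)) (x $ 1) (x $ 2)"
    unfolding quartic_def sum_multi_indices by simp
  finally show ?thesis .
qed

lemma localizing_0_superset:
  assumes "finite A" "Poly_Mapping.keys f \<subseteq> A"
  shows "localizing_0 f y = (\<Sum>\<gamma>\<in>A. Poly_Mapping.lookup f \<gamma> * y \<gamma>)"
  unfolding localizing_0_def
  by (rule sum.mono_neutral_left[OF assms]) (simp add: in_keys_iff)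

lemma localizing_0_add: "localizing_0 (f + g) y = localizing_0 f y + localizing_0 g y"
proof -
  let ?A = "Poly_Mapping.keys f \<union> Poly_Mapping.keys g"
  have "Poly_Mapping.keys (f + g) \<subseteq> ?A" by (rule keys_add)
  then show ?thesis
    by (simp add: localizing_0_superset[of ?A] lookup_add distrib_right sum.distrib)
qed

lemma localizing_0_sum: "localizing_0 (\<Sum>i\<in>I. f i) y = (\<Sum>i\<in>I. localizing_0 (f i) y)"
proof (induction I rule: infinite_finite_induct)
  case (insert i I)
  then show ?case by (simp add: localizing_0_add)
qed (simp_all add: localizing_0_def)

lemma localizing_0_single: "localizing_0 (Poly_Mapping.single \<gamma> r) y = r * y \<gamma>"
  by (simp add: localizing_0_superset[of "{\<gamma>}"])

lemma mult_eq_sum_singles: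
  fixes f g :: bipoly
  shows "f * g = (\<Sum>\<alpha>\<in>Poly_Mapping.keys f. \<Sum>\<beta>\<in>Poly_Mapping.keys g.
    Poly_Mapping.single (\<alpha> + \<beta>) (Poly_Mapping.lookup f \<alpha> * Poly_Mapping.lookup g \<beta>))"
proof -
  have "f * g = (\<Sum>\<alpha>\<in>Poly_Mapping.keys f. Poly_Mapping.single \<alpha> (Poly_Mapping.lookup f \<alpha>)) *
    (\<Sum>\<beta>\<in>Poly_Mapping.keys g. Poly_Mapping.single \<beta> (Poly_Mapping.lookup g \<beta>))"
    by (simp only: sum_single_lookup)
  also have "\<dots> = (\<Sum>\<alpha>\<in>Poly_Mapping.keys f. \<Sum>\<beta>\<in>Poly_Mapping.keys g.
    Poly_Mapping.single (\<alpha> + \<beta>) (Poly_Mapping.lookup f \<alpha> * Poly_Mapping.lookup g \<beta>))"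
    by (simp only: sum_product mult_single)
  finally show ?thesis .
qed

text \<open>On products the functional is the bilinear form of the moment matrix. The supports may
  be padded with zero coefficients, up to the full index set of the matrix.\<close>

lemma localizing_0_mult:
  assumes "Poly_Mapping.keys f \<subseteq> A" "Poly_Mapping.keys g \<subseteq> B" "finite A" "finite B"
  shows "localizing_0 (f * g) y =
    (\<Sum>\<alpha>\<in>A. \<Sum>\<beta>\<in>B. Poly_Mapping.lookup f \<alpha> * y (\<alpha> + \<beta>) * Poly_Mapping.lookup g \<beta>)"
proof -
  have "localizing_0 (f * g) y = (\<Sum>\<alpha>\<in>Poly_Mapping.keys f. \<Sum>\<beta>\<in>Poly_Mapping.keys g.
      Poly_Mapping.lookup f \<alpha> * y (\<alpha> + \<beta>) * Poly_Mapping.lookup g \<beta>)"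
    unfolding mult_eq_sum_singles localizing_0_sum localizing_0_single
    by (simp only: mult.assoc mult.commute[of "y _"])
  also have "\<dots> = (\<Sum>\<alpha>\<in>Poly_Mapping.keys f. \<Sum>\<beta>\<in>B.
      Poly_Mapping.lookup f \<alpha> * y (\<alpha> + \<beta>) * Poly_Mapping.lookup g \<beta>)"
    by (rule sum.cong[OF refl], rule sum.mono_neutral_left[OF assms(4,2)]) (simp add: in_keys_iff)
  also have "\<dots> = (\<Sum>\<alpha>\<in>A. \<Sum>\<beta>\<in>B. Poly_Mapping.lookup f \<alpha> * y (\<alpha> + \<beta>) * Poly_Mapping.lookup g \<beta>)"
    by (rule sum.mono_neutral_left[OF assms(3,1)]) (simp add: in_keys_iff)
  finally show ?thesis .
qed

lemma localizing_0_scale: "localizing_0 (bconst r * f) y = r * localizing_0 f y"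
  using localizing_0_mult[of "bconst r" "{0}" f "Poly_Mapping.keys f" y]
  by (simp add: localizing_0_def sum_distrib_left mult_ac)

text \<open>The coefficients of \<open>f\<close> are the test vector for the moment matrix.\<close>

lemma localizing_0_square_nonneg:
  assumes "psd_on (multi_indices d) (moment_matrix y)" "Poly_Mapping.keys f \<subseteq> multi_indices d"
  shows "0 \<le> localizing_0 (f\<^sup>2) y"
  using assms
  by (simp add: power2_eq_square localizing_0_mult[OF assms(2,2)] finite_multi_indices psd_on_def moment_matrix_def)

lemma keys_add_multi_indices:
  assumes "Poly_Mapping.keys f \<subseteq> multi_indices d" "Poly_Mapping.keys g \<subseteq> multi_indices d"
  shows "Poly_Mapping.keys (f + g) \<subseteq> multi_indices d"
  using assms keys_add[of f g] by blast

lemma keys_mult_multi_indices: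
  assumes "Poly_Mapping.keys f \<subseteq> multi_indices d" "Poly_Mapping.keys g \<subseteq> multi_indices e"
  shows "Poly_Mapping.keys (f * g) \<subseteq> multi_indices (d + e)"
proof
  fix \<gamma> assume "\<gamma> \<in> Poly_Mapping.keys (f * g)"
  then have "\<gamma> \<in> {a + b |a b. a \<in> Poly_Mapping.keys f \<and> b \<in> Poly_Mapping.keys g}"
    by (rule subsetD[OF keys_mult])
  then obtain \<alpha> \<beta> where "\<gamma> = \<alpha> + \<beta>" "\<alpha> \<in> Poly_Mapping.keys f" "\<beta> \<in> Poly_Mapping.keys g"
    by (elim CollectE exE conjE)
  moreover from this have "\<alpha> \<in> multi_indices d" "\<beta> \<in> multi_indices e"
    using assms by (meson subsetD)+
  ultimately show "\<gamma> \<in> multi_indices (d + e)" by (simp add: multi_indices_def weight_def)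
qed

lemma keys_affine:
  "Poly_Mapping.keys (bconst r + bconst s * X1 + bconst t * X2) \<subseteq> multi_indices 1"
  by (intro keys_add_multi_indices) (auto simp: mult_single multi_indices_def weight_def)

lemma localizing_0_numeral: "localizing_0 (numeral n * f) y = numeral n * localizing_0 f y"
  using localizing_0_scale[of "numeral n" f y] by simp

lemma localizing_0_bconst: "localizing_0 (bconst r) y = r * y (0, 0)"
  by (simp add: localizing_0_single zero_prod_def)

lemma bconst_quartic:
  "bconst (quartic c x y) = quartic (\<lambda>i j. bconst (c i j)) (bconst x) (bconst y)"
  by (simp add: quartic_expand single_add bconst_mult bconst_power)

lemma bconst_quartic_x:
  "bconst (quartic_x c x y) = quartic_x (\<lambda>i j. bconst (c i j)) (bconst x) (bconst y)"
  by (simp add: quartic_x_def single_add bconst_mult bconst_power)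

lemma bconst_quartic_y:
  "bconst (quartic_y c x y) = quartic_y (\<lambda>i j. bconst (c i j)) (bconst x) (bconst y)"
  by (simp add: quartic_y_def single_add bconst_mult bconst_power)

section \<open>The functional applied to the homogenised Hessian\<close>

lemma sum_Basis_vec_real: "sum f (Basis :: (real^'n) set) = (\<Sum>i\<in>UNIV. f (axis i 1))"
proof -
  have Basis: "(Basis :: (real^'n) set) = range (\<lambda>i. axis i 1)"
    by (auto simp: Basis_vec_def)
  show ?thesis
    unfolding Basis by (subst sum.reindex) (auto simp: inj_on_def axis_eq_axis)
qed

lemma axis_nth_if: "axis i r $ j = (if j = i then r else 0)"
  by (simp add: axis_def)

lemma pairing_real3:
  fixes a P :: "real^3 \<Rightarrow> real^3 \<Rightarrow> real"
  shows "pairing a P = (\<Sum>i\<in>UNIV. \<Sum>j\<in>UNIV. a (axis i 1) (axis j 1) * P (axis i 1) (axis j 1))"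
  by (simp add: pairing_def sum_Basis_vec_real)

lemma pairing_uminus_right: "pairing a (\<lambda>x z. - P x z) = - pairing a P"
  by (simp add: pairing_def sum_negf)

context
  fixes y :: "nat \<times> nat \<Rightarrow> real" and U1 U2 :: bipoly
begin

text \<open>\<open>(1, U1, U2)\<close> are the homogeneous coordinates of the polynomial point at
  which the Hessian will be taken; \<open>lift\<close> maps a coefficient vector to the combination
  of them.\<close>

definition lift :: "real^3 \<Rightarrow> bipoly" where
  "lift x = bconst (x $ 1) + bconst (x $ 2) * U1 + bconst (x $ 3) * U2"

text \<open>A block of the moment form: \<open>W\<close> will be \<open>V1\<^sup>2\<close>,
  \<open>V1 * V2\<close> or \<open>V2\<^sup>2\<close> for a polynomial direction
  \<open>(V1, V2)\<close>.\<close>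

definition lift_form :: "bipoly \<Rightarrow> real^3 \<Rightarrow> real^3 \<Rightarrow> real" where
  "lift_form W x z = localizing_0 (lift x * lift z * W) y"

lemma lift_add: "lift (x + z) = lift x + lift z"
  by (simp add: lift_def single_add algebra_simps)

lemma lift_scale: "lift (r *\<^sub>R x) = bconst r * lift x"
  by (simp add: lift_def bconst_mult algebra_simps)

lemma bilinear_lift_form: "bilinear (lift_form W)"
  unfolding bilinear_def linear_iff lift_form_def
  by (simp add: lift_add lift_scale distrib_left distrib_right mult.assoc mult.left_commute[of _ "bconst _"]
      localizing_0_add localizing_0_scale)

lemma lift_form_commute: "lift_form W x z = lift_form W z x"
  by (simp add: lift_form_def mult_ac)

lemma lift_axis: "lift (axis 1 1) = 1" "lift (axis 2 1) = U1" "lift (axis 3 1) = U2"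
  by (simp_all add: lift_def axis_nth_if)

text \<open>The pairing matches each coefficient of the polarised entry with the functional's value
  on the corresponding product of 1, \<open>U1\<close>, \<open>U2\<close>, times
  \<open>W\<close>.\<close>

lemma pairing_lift_hess_xx:
  "pairing (lift_form W) (\<lambda>x z. hess_xx c (x $ 1) (x $ 2) (x $ 3) (z $ 1) (z $ 2) (z $ 3)) =
    localizing_0 (hess_xx (\<lambda>i j. bconst (c i j)) 1 U1 U2 1 U1 U2 * W) y"
  by (simp add: pairing_real3 sum_3 lift_form_def lift_axis hess_xx_def axis_nth_if distrib_right mult.assoc
      localizing_0_add localizing_0_scale localizing_0_numeral)

lemma pairing_lift_hess_xy:
  "pairing (lift_form W) (\<lambda>x z. hess_xy c (x $ 1) (x $ 2) (x $ 3) (z $ 1) (z $ 2) (z $ 3)) =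
    localizing_0 (hess_xy (\<lambda>i j. bconst (c i j)) 1 U1 U2 1 U1 U2 * W) y"
  by (simp add: pairing_real3 sum_3 lift_form_def lift_axis hess_xy_def axis_nth_if distrib_right mult.assoc
      localizing_0_add localizing_0_scale localizing_0_numeral)

lemma pairing_lift_hess_yy:
  "pairing (lift_form W) (\<lambda>x z. hess_yy c (x $ 1) (x $ 2) (x $ 3) (z $ 1) (z $ 2) (z $ 3)) =
    localizing_0 (hess_yy (\<lambda>i j. bconst (c i j)) 1 U1 U2 1 U1 U2 * W) y"
  by (simp add: pairing_real3 sum_3 lift_form_def lift_axis hess_yy_def axis_nth_if distrib_right mult.assoc
      localizing_0_add localizing_0_scale localizing_0_numeral)

text \<open>The three forms \<open>lift_form\<close> make up a positive semidefinite block form,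
  since its value at \<open>(x, z)\<close> is the functional on a square. Separability then applies
  to it and the negated Hessian.\<close>

lemma localizing_0_hess_nonpos:
  assumes psd: "psd_on (multi_indices 2) (moment_matrix y)"
    and deg: "Poly_Mapping.keys U1 \<subseteq> multi_indices 1" "Poly_Mapping.keys U2 \<subseteq> multi_indices 1"
      "Poly_Mapping.keys V1 \<subseteq> multi_indices 1" "Poly_Mapping.keys V2 \<subseteq> multi_indices 1"
    and hess: "\<And>x0 x1 x2 v w. hess c x0 x1 x2 v w \<le> 0"
  shows "localizing_0 (hess (\<lambda>i j. bconst (c i j)) 1 U1 U2 V1 V2) y \<le> 0"
proof -
  let ?P = "\<lambda>x z :: real^3. - hess_xx c (x $ 1) (x $ 2) (x $ 3) (z $ 1) (z $ 2) (z $ 3)"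
  let ?Q = "\<lambda>x z :: real^3. - hess_xy c (x $ 1) (x $ 2) (x $ 3) (z $ 1) (z $ 2) (z $ 3)"
  let ?R = "\<lambda>x z :: real^3. - hess_yy c (x $ 1) (x $ 2) (x $ 3) (z $ 1) (z $ 2) (z $ 3)"
  have keys_const: "Poly_Mapping.keys (bconst r) \<subseteq> multi_indices 0" for r
    by (simp add: multi_indices_def weight_def)
  have keys_lift: "Poly_Mapping.keys (lift x) \<subseteq> multi_indices 1" for x
    unfolding lift_def
    using keys_mult_multi_indices[OF keys_const deg(1)] keys_mult_multi_indices[OF keys_const deg(2)]
    by (intro keys_add_multi_indices) (simp_all add: multi_indices_def weight_def)
  have "0 \<le> pairing (lift_form (V1\<^sup>2)) ?P + 2 * pairing (lift_form (V1 * V2)) ?Q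
      + pairing (lift_form (V2\<^sup>2)) ?R"
  proof (rule pairing_block_nonneg)
    show "0 \<le> lift_form (V1\<^sup>2) x x + 2 * lift_form (V1 * V2) x z + lift_form (V2\<^sup>2) z z" for x z
    proof -
      \<comment> \<open>Point and direction are both affine, so the squared polynomial has degree at
        most 2, exactly what the moment matrix covers.\<close>
      have "Poly_Mapping.keys (lift x * V1 + lift z * V2) \<subseteq> multi_indices 2"
        using keys_mult_multi_indices[OF keys_lift deg(3)] keys_mult_multi_indices[OF keys_lift deg(4)]
        by (intro keys_add_multi_indices) (simp_all add: numeral_2_eq_2)
      then have "0 \<le> localizing_0 ((lift x * V1 + lift z * V2)\<^sup>2) y"
        by (rule localizing_0_square_nonneg[OF psd])
      also have "(lift x * V1 + lift z * V2)\<^sup>2 =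
          lift x * lift x * V1\<^sup>2 + 2 * (lift x * lift z * (V1 * V2)) + lift z * lift z * V2\<^sup>2"
        by (simp add: power2_eq_square algebra_simps)
      finally show ?thesis
        by (simp only: lift_form_def localizing_0_add localizing_0_numeral)
    qed
    show "0 \<le> s\<^sup>2 * ?P x x + 2 * s * t * ?Q x x + t\<^sup>2 * ?R x x" for x s t
      using hess[of "x $ 1" "x $ 2" "x $ 3" s t] by (simp add: hess_def mult_ac)
    show "bilinear ?P" "bilinear ?Q" "bilinear ?R"
      by (simp_all add: bilinear_def linear_iff hess_xx_def hess_xy_def hess_yy_def algebra_simps)
  qed (simp_all only: bilinear_lift_form lift_form_commute)
  then show ?thesis
    by (simp add: pairing_uminus_right pairing_lift_hess_xx pairing_lift_hess_xy pairing_lift_hess_yy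
        hess_def localizing_0_add localizing_0_numeral mult.assoc)
qed

end

section \<open>Jensen inequality for pseudo-moments\<close>

lemma midpoint_concave_quartic:
  assumes keys: "Poly_Mapping.keys p \<subseteq> multi_indices 4" and conc: "concave_on UNIV (peval p)"
  defines "c \<equiv> \<lambda>i j. Poly_Mapping.lookup p (i, j)"
  shows "quartic c (x + v) (y + w) + quartic c (x - v) (y - w) \<le> 2 * quartic c x y"
proof -
  let ?A = "vector [x + v, y + w] :: real^2" and ?B = "vector [x - v, y - w] :: real^2"
  have mid: "(1 - 1/2) *\<^sub>R ?A + (1/2) *\<^sub>R ?B = vector [x, y]"
    by (simp add: vec_eq_iff forall_2 field_simps)
  have "- peval p ((1 - 1/2) *\<^sub>R ?A + (1/2) *\<^sub>R ?B) \<le> (1 - 1/2) * - peval p ?A + (1/2) * - peval p ?B"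
    using conc unfolding concave_on_def by (intro convex_onD) auto
  then show ?thesis
    unfolding mid by (simp add: peval_eq_quartic[OF keys] c_def)
qed

text \<open>Taylor's formula is applied inside the polynomial ring, from the constant point
  \<open>(u, v)\<close> to the generic point \<open>(X1, X2)\<close>, and then the functional is
  taken.\<close>

lemma pseudo_moment_jensen:
  assumes keys: "Poly_Mapping.keys p \<subseteq> multi_indices 4" and conc: "concave_on UNIV (peval p)"
    and y: "y (0, 0) = 1" "y (1, 0) = x $ 1" "y (0, 1) = x $ 2"
    and psd: "psd_on (multi_indices 2) (moment_matrix y)"
  shows "localizing_0 p y \<le> peval p x"
proof -
  define c where "c = (\<lambda>i j. Poly_Mapping.lookup p (i, j))"
  define C where "C = (\<lambda>i j. bconst (c i j))"
  define u v where "u = bconst (x $ 1)" and "v = bconst (x $ 2)"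
  \<comment> \<open>\<open>V1\<close> and \<open>V2\<close> are half the displacement from the mean,
    as \<open>quartic_taylor\<close> steps by \<open>2 * v\<close>; thus
    \<open>(u + V1, v + V2)\<close> is the midpoint.\<close>
  define V1 where "V1 = bconst (- (x $ 1) / 2) + bconst (1/2) * X1 + bconst 0 * X2"
  define V2 where "V2 = bconst (- (x $ 2) / 2) + bconst 0 * X1 + bconst (1/2) * X2"
  have hess: "hess c x0 x1 x2 v w \<le> 0" for x0 x1 x2 v w
    using midpoint_concave_quartic[OF keys conc] unfolding c_def
    by (rule hess_nonpos_of_midpoint_concave)
  have deg_V: "Poly_Mapping.keys V1 \<subseteq> multi_indices 1" "Poly_Mapping.keys V2 \<subseteq> multi_indices 1"
    unfolding V1_def V2_def by (rule keys_affine)+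
  have deg_u: "Poly_Mapping.keys u \<subseteq> multi_indices 1" "Poly_Mapping.keys v \<subseteq> multi_indices 1"
    by (auto simp: u_def v_def multi_indices_def weight_def)
  have X: "X1 = u + 2 * V1" "X2 = v + 2 * V2"
    by (simp_all add: u_def v_def V1_def V2_def distrib_left mult.assoc[symmetric] bconst_numeral[symmetric]
        mult_single single_add[symmetric] del: bconst_numeral single_numeral)
  have mean: "localizing_0 V1 y = 0" "localizing_0 V2 y = 0"
    using y by (simp_all add: V1_def V2_def localizing_0_add localizing_0_scale localizing_0_bconst
        localizing_0_single[of "(_, _)"] del: single_zero)
  have "p = quartic C X1 X2"
    using bipoly_eq_quartic[OF keys] by (simp add: C_def c_def)
  then have "6 * p = 6 * quartic C u v + 12 * (quartic_x C u v * V1 + quartic_y C u v * V2)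
      + 4 * hess C 1 u v V1 V2 + 8 * hess C 1 (u + V1) (v + V2) V1 V2"
    unfolding X by (simp only: quartic_taylor)
  also have "quartic C u v = bconst (peval p x)"
    by (simp add: bconst_quartic peval_eq_quartic[OF keys] C_def c_def u_def v_def)
  also have "quartic_x C u v = bconst (quartic_x c (x $ 1) (x $ 2))"
    by (simp add: bconst_quartic_x C_def u_def v_def)
  also have "quartic_y C u v = bconst (quartic_y c (x $ 1) (x $ 2))"
    by (simp add: bconst_quartic_y C_def u_def v_def)
  finally have "localizing_0 (6 * p) y = localizing_0 (6 * bconst (peval p x) +
      12 * (bconst (quartic_x c (x $ 1) (x $ 2)) * V1 + bconst (quartic_y c (x $ 1) (x $ 2)) * V2)
      + 4 * hess C 1 u v V1 V2 + 8 * hess C 1 (u + V1) (v + V2) V1 V2) y"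
    by (rule arg_cong)
  \<comment> \<open>The first-order terms vanish: the gradient at the mean is constant and the
    functional kills \<open>V1\<close> and \<open>V2\<close>.\<close>
  then have "6 * localizing_0 p y = 6 * peval p x + 4 * localizing_0 (hess C 1 u v V1 V2) y
      + 8 * localizing_0 (hess C 1 (u + V1) (v + V2) V1 V2) y"
    by (simp only: localizing_0_add localizing_0_numeral localizing_0_scale localizing_0_bconst mean y) simp
  moreover have "localizing_0 (hess C 1 u v V1 V2) y \<le> 0"
    unfolding C_def by (intro localizing_0_hess_nonpos psd deg_V deg_u hess)
  moreover have "localizing_0 (hess C 1 (u + V1) (v + V2) V1 V2) y \<le> 0"
    unfolding C_def by (intro localizing_0_hess_nonpos psd deg_V deg_u hess keys_add_multi_indices)
  ultimately show ?thesis by simp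
qed

section \<open>The relaxation as a convex set containing the curve\<close>

text \<open>The moments \<open>m\<close> of the point mass at \<open>x\<close> are feasible: they
  are multiplicative, so the moment matrix has rank one and its quadratic form is a square.\<close>

lemma curve_subset_moment_relaxation_2: "real_curve p \<subseteq> moment_relaxation_2 p"
proof
  fix x assume x: "x \<in> real_curve p"
  define m where "m \<alpha> = (x $ 1) ^ fst \<alpha> * (x $ 2) ^ snd \<alpha>" for \<alpha> :: "nat \<times> nat"
  have m_add: "m (\<alpha> + \<beta>) = m \<alpha> * m \<beta>" for \<alpha> \<beta>
    by (simp add: m_def power_add)
  have "(\<Sum>\<alpha>\<in>multi_indices 2. \<Sum>\<beta>\<in>multi_indices 2. v \<alpha> * (m \<alpha> * m \<beta>) * v \<beta>) =
      (\<Sum>\<alpha>\<in>multi_indices 2. v \<alpha> * m \<alpha>)\<^sup>2" for v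
    unfolding power2_eq_square sum_product by (intro sum.cong refl) (simp only: mult_ac)
  then have "psd_on (multi_indices 2) (moment_matrix m)"
    by (simp add: psd_on_def moment_matrix_def m_add)
  moreover have "localizing_0 p m = 0"
    using x by (simp add: real_curve_def peval_def localizing_0_def m_def)
  ultimately show "x \<in> moment_relaxation_2 p"
    unfolding moment_relaxation_2_def by (intro CollectI exI[of _ m]) (simp add: m_def)
qed

lemma psd_on_convex_combination:
  assumes "psd_on I A" "psd_on I B" "0 \<le> s" "0 \<le> t"
  shows "psd_on I (\<lambda>i j. s * A i j + t * B i j)"
proof -
  have "(\<Sum>i\<in>I. \<Sum>j\<in>I. v i * (s * A i j + t * B i j) * v j) =
    s * (\<Sum>i\<in>I. \<Sum>j\<in>I. v i * A i j * v j) + t * (\<Sum>i\<in>I. \<Sum>j\<in>I. v i * B i j * v j)" for v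
    by (simp add: sum_distrib_left sum.distrib[symmetric] algebra_simps)
  then show ?thesis using assms by (simp add: psd_on_def)
qed

text \<open>Every condition on the moment vector survives convex combinations, and the mean depends
  linearly on it.\<close>

lemma convex_moment_relaxation_2: "convex (moment_relaxation_2 p)"
proof (rule convexI)
  fix x z :: "real^2" and s t :: real
  assume xz: "x \<in> moment_relaxation_2 p" "z \<in> moment_relaxation_2 p" and st: "0 \<le> s" "0 \<le> t" "s + t = 1"
  obtain f where f: "f (0, 0) = 1" "f (1, 0) = x $ 1" "f (0, 1) = x $ 2"
    "psd_on (multi_indices 2) (moment_matrix f)" "localizing_0 p f = 0"
    using xz(1) by (auto simp: moment_relaxation_2_def)
  obtain g where g: "g (0, 0) = 1" "g (1, 0) = z $ 1" "g (0, 1) = z $ 2"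
    "psd_on (multi_indices 2) (moment_matrix g)" "localizing_0 p g = 0"
    using xz(2) by (auto simp: moment_relaxation_2_def)
  let ?h = "\<lambda>\<alpha>. s * f \<alpha> + t * g \<alpha>"
  have "localizing_0 p ?h = s * localizing_0 p f + t * localizing_0 p g"
    by (simp add: localizing_0_def sum_distrib_left sum.distrib[symmetric] algebra_simps)
  moreover have "psd_on (multi_indices 2) (moment_matrix ?h)"
    using psd_on_convex_combination[OF f(4) g(4) st(1,2)] by (simp add: moment_matrix_def[abs_def])
  ultimately show "s *\<^sub>R x + t *\<^sub>R z \<in> moment_relaxation_2 p"
    unfolding moment_relaxation_2_def using f g st by (intro CollectI exI[of _ ?h]) simp
qed

theorem lemma5:
  fixes p :: bipoly
  assumes "total_degree p = 4"
    and "interior (convex hull (real_curve p)) \<noteq> {}"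
    and "{x. peval p x \<ge> 0} \<subseteq> convex hull (real_curve p)"
    and "concave_on UNIV (peval p)"
  shows "convex hull (real_curve p) = moment_relaxation_2 p"
proof
  show "convex hull (real_curve p) \<subseteq> moment_relaxation_2 p"
    by (intro hull_minimal curve_subset_moment_relaxation_2 convex_moment_relaxation_2)
  have keys: "Poly_Mapping.keys p \<subseteq> multi_indices 4"
    using keys_subset_multi_indices[of p] assms(1) by simp
  show "moment_relaxation_2 p \<subseteq> convex hull (real_curve p)"
  proof
    fix x assume "x \<in> moment_relaxation_2 p"
    then obtain y where "y (0, 0) = 1" "y (1, 0) = x $ 1" "y (0, 1) = x $ 2"
      "psd_on (multi_indices 2) (moment_matrix y)" "localizing_0 p y = 0"
      by (auto simp: moment_relaxation_2_def)
    then have "0 \<le> peval p x"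
      using pseudo_moment_jensen[OF keys assms(4), of y x] by simp
    then show "x \<in> convex hull (real_curve p)" using assms(3) by blast
  qed
qed

end
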